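(* Let $a,b>0$ and $v\in(0,1)$. Put $h=\frac{b}{a}$, $r=\min\{v,1-v\}$, $r_1=\min\{2r,1-2r\}$ and $\hat r_1=\min\{2r_1,1-2r_1\}$. Then $$\frac{a+b}{2}\ \ge\ r(\sqrt a-\sqrt b)^2+\frac12 r_1\Bigl[(\sqrt[4]{ab}-\sqrt a)^2+(\sqrt[4]{ab}-\sqrt b)^2\Bigr]+\mathrm{K}(\sqrt[4]{h},2)^{\hat r_1}H_v(a,b).$$
   Context: For $t>0$, $\mathrm{K}(t,2)=\frac{(t+1)^2}{4t}$ denotes the Kantorovich constant. The Heinz mean is $H_v(a,b)=\frac{a^vb^{1-v}+a^{1-v}b^v}{2}$ for $a,b>0$, $0\le v\le1$. *)

theory Defs
  imports Complex_Main
begin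

(* The Kantorovich constant K(t,2); only meaningful for t > 0. *)
definition kantorovich2 :: "real \<Rightarrow> real" where
  "kantorovich2 t = (t + 1)\<^sup>2 / (4 * t)"

(* Only meaningful for a, b > 0 and 0 \<le> v \<le> 1. *)
definition heinz_mean :: "real \<Rightarrow> real \<Rightarrow> real \<Rightarrow> real" where
  "heinz_mean v a b = (a powr v * b powr (1 - v) + a powr (1 - v) * b powr v) / 2"

end

theory Submission
  imports Defs "HOL-Analysis.Convex"
begin

text \<open>
  Subtracting \<open>v (\<surd>a - \<surd>b)\<^sup>2\<close> from \<open>(1 - v) a + v b\<close>, for \<open>v \<le> 1/2\<close>,
  leaves the weighted mean \<open>(1 - 2v) a + 2v \<surd>(ab)\<close>. Doing this twice exhausts both squares, and the
  remaining mean is estimated by Young's inequality with the Kantorovich constant, which in turn is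
  the weighted AM-GM inequality for \<open>X\<close> and \<open>(X + Y)/2\<close>. The theorem is the average of the resulting
  bounds for \<open>(a, b)\<close> and \<open>(b, a)\<close>.
\<close>

lemma kantorovich2_inverse:
  assumes "t > 0"
  shows "kantorovich2 (1 / t) = kantorovich2 t"
  using assms by (simp add: kantorovich2_def field_simps power2_eq_square)

lemma kantorovich2_pos: "t > 0 \<Longrightarrow> kantorovich2 t > 0"
  by (simp add: kantorovich2_def)

text \<open>This identifies the constant at \<open>y / x\<close> as the squared ratio of the
  arithmetic to the geometric mean of \<open>x\<close> and \<open>y\<close>.\<close>

lemma kantorovich2_quotient:
  assumes "x > 0" "y > 0"
  shows "kantorovich2 (y / x) * x * y = ((x + y) / 2)\<^sup>2"
  using assms by (simp add: kantorovich2_def field_simps power2_eq_square)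

lemma heinz_mean_flip: "heinz_mean (1 - v) a b = heinz_mean v a b"
  by (simp add: heinz_mean_def)

lemma weighted_mean_split_square:
  fixes x y w :: real
  assumes "x \<ge> 0" "y \<ge> 0"
  shows "(1 - w) * x + w * y = w * (sqrt x - sqrt y)\<^sup>2 + ((1 - 2 * w) * x + 2 * w * sqrt (x * y))"
  using assms by (simp add: power2_diff real_sqrt_mult algebra_simps)

text \<open>Passing from \<open>(x, y)\<close> with weight \<open>w\<close> to
  \<open>(x, sqrt (x * y))\<close> with weight \<open>2 * w\<close> splits a square off the
  arithmetic side only; the product side survives unchanged, so the step can be iterated.\<close>

lemma powr_weighted_geometric_mean_sqrt:
  fixes x y w :: real
  assumes "x > 0" "y > 0"
  shows "x powr (1 - 2 * w) * sqrt (x * y) powr (2 * w) = x powr (1 - w) * y powr w"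
proof -
  have "sqrt (x * y) powr (2 * w) = x powr w * y powr w"
    using assms by (simp add: powr_powr powr_mult flip: powr_half_sqrt)
  then show ?thesis by (simp add: powr_add[symmetric] flip: mult.assoc)
qed

lemma young_kantorovich_le_half:
  fixes x y s :: real
  assumes x: "x > 0" and y: "y > 0" and s: "0 \<le> s" "s \<le> 1 / 2"
  shows "kantorovich2 (y / x) powr s * (x powr (1 - s) * y powr s) \<le> (1 - s) * x + s * y"
proof -
  let ?K = "kantorovich2 (y / x)"
  have K: "?K > 0" using x y by (simp add: kantorovich2_pos)
  \<comment> \<open>The exponent \<open>2 * s\<close> is read as a square raised to
    \<open>s\<close>, since the square of the midpoint is what contains \<open>?K\<close>.\<close>
  have "((x + y) / 2) powr (2 * s) = (((x + y) / 2) powr 2) powr s"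
    by (simp only: powr_powr)
  also have "\<dots> = (?K * x * y) powr s"
    using x y by (simp only: kantorovich2_quotient[OF x y]) simp
  also have "\<dots> = ?K powr s * x powr s * y powr s"
    using x y K by (simp add: powr_mult)
  finally have m: "((x + y) / 2) powr (2 * s) = ?K powr s * x powr s * y powr s" .
  have "x powr (1 - s) = x powr (1 - 2 * s) * x powr s"
    by (simp flip: powr_add)
  then have "?K powr s * (x powr (1 - s) * y powr s) = x powr (1 - 2 * s) * ((x + y) / 2) powr (2 * s)"
    unfolding m by simp
  \<comment> \<open>The weight \<open>1 - 2 * s\<close> is nonnegative because
    \<open>s \<le> 1 / 2\<close>.\<close>
  also have "\<dots> \<le> (1 - 2 * s) * x + 2 * s * ((x + y) / 2)"
    using x y s by (intro Youngs_inequality_0) auto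
  also have "\<dots> = (1 - s) * x + s * y" by (simp add: field_simps)
  finally show ?thesis .
qed

text \<open>Exchanging \<open>x\<close> and \<open>y\<close> turns \<open>s\<close> into
  \<open>1 - s\<close> and inverts the argument of the constant, which does not change its value.
  The full range of \<open>s\<close> matters: the weight \<open>2 * w\<close> below can exceed
  \<open>1 / 2\<close>.\<close>

lemma young_kantorovich:
  fixes x y s :: real
  assumes x: "x > 0" and y: "y > 0" and s: "0 \<le> s" "s \<le> 1"
  shows "kantorovich2 (y / x) powr (min s (1 - s)) * (x powr (1 - s) * y powr s) \<le> (1 - s) * x + s * y"
proof (cases "s \<le> 1 / 2")
  case True
  then show ?thesis using young_kantorovich_le_half[OF x y] s by simp
next
  case False
  then have "kantorovich2 (x / y) powr (1 - s) * (y powr s * x powr (1 - s)) \<le> s * y + (1 - s) * x"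
    using young_kantorovich_le_half[OF y x, of "1 - s"] s by simp
  moreover have "kantorovich2 (x / y) = kantorovich2 (y / x)"
    using kantorovich2_inverse[of "y / x"] x y by simp
  ultimately show ?thesis using False by (simp add: mult_ac min_def)
qed

lemma young_kantorovich_refined_le_half:
  fixes x y w :: real
  assumes x: "x > 0" and y: "y > 0" and w: "0 \<le> w" "w \<le> 1 / 2"
  shows "w * (sqrt x - sqrt y)\<^sup>2
      + kantorovich2 (sqrt (y / x)) powr (min (2 * w) (1 - 2 * w)) * (x powr (1 - w) * y powr w)
    \<le> (1 - w) * x + w * y"
proof -
  have q: "sqrt (x * y) / x = sqrt (y / x)"
    using x y by (simp add: real_sqrt_mult real_sqrt_divide field_simps)
  have "kantorovich2 (sqrt (y / x)) powr (min (2 * w) (1 - 2 * w)) * (x powr (1 - w) * y powr w)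
      \<le> (1 - 2 * w) * x + 2 * w * sqrt (x * y)"
    using young_kantorovich[of x "sqrt (x * y)" "2 * w"] x y w
    by (simp add: q powr_weighted_geometric_mean_sqrt)
  then show ?thesis using weighted_mean_split_square[of x y w] x y by simp
qed

lemma young_kantorovich_refined:
  fixes x y w q :: real
  assumes x: "x > 0" and y: "y > 0" and w: "0 \<le> w" "w \<le> 1" and q: "q = min w (1 - w)"
  shows "q * (sqrt x - sqrt y)\<^sup>2
      + kantorovich2 (sqrt (y / x)) powr (min (2 * q) (1 - 2 * q)) * (x powr (1 - w) * y powr w)
    \<le> (1 - w) * x + w * y"
proof (cases "w \<le> 1 / 2")
  case True
  then show ?thesis using young_kantorovich_refined_le_half[OF x y] w q by simp
next
  case False
  then have "q = 1 - w" using q by simp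
  moreover have "kantorovich2 (sqrt (x / y)) = kantorovich2 (sqrt (y / x))"
    using kantorovich2_inverse[of "sqrt (y / x)"] x y by (simp add: real_sqrt_divide)
  ultimately show ?thesis
    using young_kantorovich_refined_le_half[OF y x, of "1 - w"] w False
    by (simp add: mult_ac add_ac power2_commute[of "sqrt x"])
qed

lemma root_4_eq_sqrt_sqrt: "root 4 x = sqrt (sqrt x)"
  using real_root_mult_exp[of 2 2 x] by (simp add: sqrt_def)

text \<open>After the first square, the once-refined bound applies to \<open>a\<close> and
  \<open>sqrt (a * b)\<close> with weight \<open>2 * v\<close>; the square roots taken there produce
  the fourth roots.\<close>

lemma young_kantorovich_refined_twice_le_half:
  fixes a b v q :: real
  assumes a: "a > 0" and b: "b > 0" and v: "0 \<le> v" "v \<le> 1 / 2"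
    and q: "q = min (2 * v) (1 - 2 * v)"
  shows "v * (sqrt a - sqrt b)\<^sup>2 + q * (root 4 (a * b) - sqrt a)\<^sup>2
      + kantorovich2 (root 4 (b / a)) powr (min (2 * q) (1 - 2 * q)) * (a powr (1 - v) * b powr v)
    \<le> (1 - v) * a + v * b"
proof -
  have r: "sqrt (sqrt (a * b) / a) = root 4 (b / a)"
    using a b by (simp add: root_4_eq_sqrt_sqrt real_sqrt_mult real_sqrt_divide field_simps)
  have "q * (root 4 (a * b) - sqrt a)\<^sup>2
      + kantorovich2 (root 4 (b / a)) powr (min (2 * q) (1 - 2 * q)) * (a powr (1 - v) * b powr v)
      \<le> (1 - 2 * v) * a + 2 * v * sqrt (a * b)"
    using young_kantorovich_refined[of a "sqrt (a * b)" "2 * v" q] a b v q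
    by (simp add: r root_4_eq_sqrt_sqrt powr_weighted_geometric_mean_sqrt
        power2_commute[of "sqrt a"])
  then show ?thesis using weighted_mean_split_square[of a b v] a b by simp
qed

lemma heinz_kantorovich_le_half:
  fixes a b v q :: real
  assumes a: "a > 0" and b: "b > 0" and v: "0 \<le> v" "v \<le> 1 / 2"
    and q: "q = min (2 * v) (1 - 2 * v)"
  shows "v * (sqrt a - sqrt b)\<^sup>2
      + 1 / 2 * q * ((root 4 (a * b) - sqrt a)\<^sup>2 + (root 4 (a * b) - sqrt b)\<^sup>2)
      + kantorovich2 (root 4 (b / a)) powr (min (2 * q) (1 - 2 * q)) * heinz_mean v a b
    \<le> (a + b) / 2"
proof -
  let ?K = "kantorovich2 (root 4 (b / a)) powr (min (2 * q) (1 - 2 * q))"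
  \<comment> \<open>Both orders of \<open>a\<close> and \<open>b\<close> thus carry the same factor
    \<open>?K\<close>, so averaging the two products gives the Heinz mean.\<close>
  have "kantorovich2 (root 4 (a / b)) = kantorovich2 (root 4 (b / a))"
    using kantorovich2_inverse[of "root 4 (b / a)"] a b by (simp add: real_root_divide)
  then have "v * (sqrt a - sqrt b)\<^sup>2 + q * (root 4 (a * b) - sqrt b)\<^sup>2
      + ?K * (b powr (1 - v) * a powr v) \<le> (1 - v) * b + v * a"
    using young_kantorovich_refined_twice_le_half[OF b a v q]
    by (simp add: mult.commute[of b a] power2_commute[of "sqrt b" "sqrt a"])
  moreover have "v * (sqrt a - sqrt b)\<^sup>2 + q * (root 4 (a * b) - sqrt a)\<^sup>2
      + ?K * (a powr (1 - v) * b powr v) \<le> (1 - v) * a + v * b"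
    using young_kantorovich_refined_twice_le_half[OF a b v q] .
  ultimately show ?thesis by (simp add: heinz_mean_def field_simps)
qed

theorem mainTheorem7:
  fixes a b v h r r\<^sub>1 r\<^sub>1' :: real
  assumes "a > 0" and "b > 0"
    and "0 < v" and "v < 1"
    and "h = b / a"
    and "r = min v (1 - v)"
    and "r\<^sub>1 = min (2 * r) (1 - 2 * r)"
    and "r\<^sub>1' = min (2 * r\<^sub>1) (1 - 2 * r\<^sub>1)"
  shows "(a + b) / 2 \<ge>
      r * (sqrt a - sqrt b)\<^sup>2
      + 1 / 2 * r\<^sub>1 * ((root 4 (a * b) - sqrt a)\<^sup>2 + (root 4 (a * b) - sqrt b)\<^sup>2)
      + kantorovich2 (root 4 h) powr r\<^sub>1' * heinz_mean v a b"
proof -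
  \<comment> \<open>By symmetry in \<open>v\<close> and \<open>1 - v\<close>, the weight may be
    taken to be \<open>r \<le> 1 / 2\<close>.\<close>
  have "heinz_mean r a b = heinz_mean v a b"
    using assms(6) by (simp add: min_def heinz_mean_flip)
  moreover have "0 \<le> r" "r \<le> 1 / 2" using assms(3,4,6) by linarith+
  ultimately show ?thesis
    using heinz_kantorovich_le_half[OF assms(1,2) _ _ assms(7)] assms(5,8) by simp
qed

end
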